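(* Let $(D,\prec,\succ)$ be a dendriform algebra and $(R,S)$ a Rota-Baxter system on $D$. Then $(D,\nwarrow,\nearrow,\swarrow,\searrow)$ is a quadri-algebra, where $$a\nwarrow b=a\prec S(b),\quad a\nearrow b=a\succ S(b),\quad a\swarrow b=R(a)\prec b,\quad a\searrow b=R(a)\succ b.$$
   Context: All vector spaces are over a field of characteristic zero. A dendriform algebra $(D,\prec,\succ)$ satisfies $(a\prec b)\prec c=a\prec(b\prec c+b\succ c)$, $(a\succ b)\prec c=a\succ(b\prec c)$, $(a\prec b+a\succ b)\succ c=a\succ(b\succ c)$. A Rota-Baxter system on $D$ is a pair of linear maps $R,S:D\to D$ such that for all $a,b\in D$: $R(a)\prec R(b)=R(R(a)\prec b+a\prec S(b))$, $S(a)\prec S(b)=S(R(a)\prec b+a\prec S(b))$, $R(a)\succ R(b)=R(R(a)\succ b+a\succ S(b))$, $S(a)\succ S(b)=S(R(a)\succ b+a\succ S(b))$. A quadri-algebra is a vector space with four bilinear operations $\nwarrow,\nearrow,\swarrow,\searrow$ such that, writing $a\sqsubset b=a\nwarrow b+a\swarrow b$, $a\sqsupset b=a\nearrow b+a\searrow b$, $a\wedge b=a\nwarrow b+a\nearrow b$, $a\vee b=a\swarrow b+a\searrow b$, and $a*b$ for the sum of all four, the following nine identities hold: \begin{align*} &(a\nwarrow b)\nwarrow c=a\nwarrow(b*c),&&(a\nearrow b)\nwarrow c=a\nearrow(b\sqsubset c),&&(a\wedge b)\nearrow c=a\nearrow(b\sqsupset c),\\ &(a\swarrow b)\nwarrow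 c=a\swarrow(b\wedge c),&&(a\searrow b)\nwarrow c=a\searrow(b\nwarrow c),&&(a\vee b)\nearrow c=a\searrow(b\nearrow c),\\ &(a\sqsubset b)\swarrow c=a\swarrow(b\vee c),&&(a\sqsupset b)\swarrow c=a\searrow(b\swarrow c),&&(a*b)\searrow c=a\searrow(b\searrow c). \end{align*} *)

theory Defs
  imports Complex_Main
begin

definition bilinear_op ::
    "('k::field \<Rightarrow> 'v::ab_group_add \<Rightarrow> 'v) \<Rightarrow> ('v \<Rightarrow> 'v \<Rightarrow> 'v) \<Rightarrow> bool" where
  "bilinear_op scale f \<longleftrightarrow>
     (\<forall>a. Vector_Spaces.linear scale scale (\<lambda>b. f a b)) \<and>
     (\<forall>b. Vector_Spaces.linear scale scale (\<lambda>a. f a b))"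

locale dendriform_algebra = vector_space scale
  for scale :: "'k::field_char_0 \<Rightarrow> 'v::ab_group_add \<Rightarrow> 'v" +
  fixes prec :: "'v \<Rightarrow> 'v \<Rightarrow> 'v"  (infixl "\<prec>" 70)
    and succ :: "'v \<Rightarrow> 'v \<Rightarrow> 'v"  (infixl "\<succ>" 70)
  assumes bilinear_prec: "bilinear_op scale prec"
    and bilinear_succ: "bilinear_op scale succ"
    and prec_prec: "(a \<prec> b) \<prec> c = a \<prec> (b \<prec> c + b \<succ> c)"
    and succ_prec: "(a \<succ> b) \<prec> c = a \<succ> (b \<prec> c)"
    and succ_succ: "(a \<prec> b + a \<succ> b) \<succ> c = a \<succ> (b \<succ> c)"

locale rota_baxter_system = dendriform_algebra scale prec succ
  for scale :: "'k::field_char_0 \<Rightarrow> 'v::ab_group_add \<Rightarrow> 'v"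
    and prec :: "'v \<Rightarrow> 'v \<Rightarrow> 'v"  (infixl "\<prec>" 70)
    and succ :: "'v \<Rightarrow> 'v \<Rightarrow> 'v"  (infixl "\<succ>" 70) +
  fixes R S :: "'v \<Rightarrow> 'v"
  assumes linear_R: "Vector_Spaces.linear scale scale R"
    and linear_S: "Vector_Spaces.linear scale scale S"
    and R_prec: "R a \<prec> R b = R (R a \<prec> b + a \<prec> S b)"
    and S_prec: "S a \<prec> S b = S (R a \<prec> b + a \<prec> S b)"
    and R_succ: "R a \<succ> R b = R (R a \<succ> b + a \<succ> S b)"
    and S_succ: "S a \<succ> S b = S (R a \<succ> b + a \<succ> S b)"

locale quadri_operations =
  fixes nw :: "'v::ab_group_add \<Rightarrow> 'v \<Rightarrow> 'v"  (infixl "\<nwarrow>" 70)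
    and ne :: "'v \<Rightarrow> 'v \<Rightarrow> 'v"  (infixl "\<nearrow>" 70)
    and sw :: "'v \<Rightarrow> 'v \<Rightarrow> 'v"  (infixl "\<swarrow>" 70)
    and se :: "'v \<Rightarrow> 'v \<Rightarrow> 'v"  (infixl "\<searrow>" 70)
begin

definition left_op :: "'v \<Rightarrow> 'v \<Rightarrow> 'v"  (infixl "\<sqsubset>" 70) where
  "a \<sqsubset> b = a \<nwarrow> b + a \<swarrow> b"

definition right_op :: "'v \<Rightarrow> 'v \<Rightarrow> 'v"  (infixl "\<sqsupset>" 70) where
  "a \<sqsupset> b = a \<nearrow> b + a \<searrow> b"

definition up_op :: "'v \<Rightarrow> 'v \<Rightarrow> 'v"  (infixl "\<^bold>\<and>" 70) where
  "a \<^bold>\<and> b = a \<nwarrow> b + a \<nearrow> b"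

definition down_op :: "'v \<Rightarrow> 'v \<Rightarrow> 'v"  (infixl "\<^bold>\<or>" 70) where
  "a \<^bold>\<or> b = a \<swarrow> b + a \<searrow> b"

definition total_op :: "'v \<Rightarrow> 'v \<Rightarrow> 'v"  (infixl "\<^bold>*" 70) where
  "a \<^bold>* b = a \<nwarrow> b + a \<nearrow> b + a \<swarrow> b + a \<searrow> b"

end

locale quadri_algebra = vector_space scale + quadri_operations nw ne sw se
  for scale :: "'k::field_char_0 \<Rightarrow> 'v::ab_group_add \<Rightarrow> 'v"
    and nw :: "'v \<Rightarrow> 'v \<Rightarrow> 'v"  (infixl "\<nwarrow>" 70)
    and ne :: "'v \<Rightarrow> 'v \<Rightarrow> 'v"  (infixl "\<nearrow>" 70)
    and sw :: "'v \<Rightarrow> 'v \<Rightarrow> 'v"  (infixl "\<swarrow>" 70)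
    and se :: "'v \<Rightarrow> 'v \<Rightarrow> 'v"  (infixl "\<searrow>" 70) +
  assumes bilinear_nw: "bilinear_op scale nw"
    and bilinear_ne: "bilinear_op scale ne"
    and bilinear_sw: "bilinear_op scale sw"
    and bilinear_se: "bilinear_op scale se"
    and nw_nw: "(a \<nwarrow> b) \<nwarrow> c = a \<nwarrow> (b \<^bold>* c)"
    and ne_nw: "(a \<nearrow> b) \<nwarrow> c = a \<nearrow> (b \<sqsubset> c)"
    and up_ne: "(a \<^bold>\<and> b) \<nearrow> c = a \<nearrow> (b \<sqsupset> c)"
    and sw_nw: "(a \<swarrow> b) \<nwarrow> c = a \<swarrow> (b \<^bold>\<and> c)"
    and se_nw: "(a \<searrow> b) \<nwarrow> c = a \<searrow> (b \<nwarrow> c)"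
    and down_ne: "(a \<^bold>\<or> b) \<nearrow> c = a \<searrow> (b \<nearrow> c)"
    and left_sw: "(a \<sqsubset> b) \<swarrow> c = a \<swarrow> (b \<^bold>\<or> c)"
    and right_sw: "(a \<sqsupset> b) \<swarrow> c = a \<searrow> (b \<swarrow> c)"
    and total_se: "(a \<^bold>* b) \<searrow> c = a \<searrow> (b \<searrow> c)"

end

theory Submission
  imports Defs
begin

text \<open>The Rota-Baxter identities say that \<open>R\<close> and \<open>S\<close> turn the combined operations
  \<open>\<sqsubset>\<close>, \<open>\<sqsupset>\<close> and their sum into \<open>\<prec>\<close>, \<open>\<succ>\<close> and their sum, so each of the nine quadri-algebra
  identities is a dendriform identity with \<open>R\<close> or \<open>S\<close> applied to suitable arguments.\<close>

lemma bilinear_op_compose_left: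
  assumes "bilinear_op scale f" "Vector_Spaces.linear scale scale T"
  shows "bilinear_op scale (\<lambda>a b. f (T a) b)"
  using assms Vector_Spaces.linear_compose[OF assms(2), unfolded comp_def]
  unfolding bilinear_op_def by blast

lemma bilinear_op_compose_right:
  assumes "bilinear_op scale f" "Vector_Spaces.linear scale scale T"
  shows "bilinear_op scale (\<lambda>a b. f a (T b))"
  using assms Vector_Spaces.linear_compose[OF assms(2), unfolded comp_def]
  unfolding bilinear_op_def by blast

theorem proposition7p3:
  fixes scale :: "'k::field_char_0 \<Rightarrow> 'v::ab_group_add \<Rightarrow> 'v"
    and prec succ :: "'v \<Rightarrow> 'v \<Rightarrow> 'v"
    and R S :: "'v \<Rightarrow> 'v"
  assumes "dendriform_algebra scale prec succ"
    and "rota_baxter_system scale prec succ R S"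
  shows "quadri_algebra scale
           (\<lambda>a b. prec a (S b)) (\<lambda>a b. succ a (S b))
           (\<lambda>a b. prec (R a) b) (\<lambda>a b. succ (R a) b)"
proof -
  interpret rota_baxter_system scale prec succ R S by fact
  interpret R: Vector_Spaces.linear scale scale R by (rule linear_R)
  interpret S: Vector_Spaces.linear scale scale S by (rule linear_S)
  interpret Q: quadri_operations
    "\<lambda>a b. prec a (S b)" "\<lambda>a b. succ a (S b)"
    "\<lambda>a b. prec (R a) b" "\<lambda>a b. succ (R a) b" .
  note ops = Q.left_op_def Q.right_op_def Q.up_op_def Q.down_op_def Q.total_op_def
  \<comment> \<open>The Rota-Baxter identities list the two summands in the opposite order, hence
    \<open>add.commute\<close>.\<close>
  have R_left: "R (Q.left_op a b) = prec (R a) (R b)"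
    and S_left: "S (Q.left_op a b) = prec (S a) (S b)"
    and R_right: "R (Q.right_op a b) = succ (R a) (R b)"
    and S_right: "S (Q.right_op a b) = succ (S a) (S b)" for a b
    by (simp_all add: ops R_prec S_prec R_succ S_succ add.commute)
  \<comment> \<open>Splitting into left and right, not up and down, lets additivity of
    \<open>R\<close> and \<open>S\<close> reduce the total operation to the four rules
    above.\<close>
  have total: "Q.total_op a b = Q.left_op a b + Q.right_op a b" for a b
    by (simp add: ops algebra_simps)
  have R_total: "R (Q.total_op a b) = prec (R a) (R b) + succ (R a) (R b)" for a b
    by (simp only: total R.add R_left R_right)
  have S_total: "S (Q.total_op a b) = prec (S a) (S b) + succ (S a) (S b)" for a b
    by (simp only: total S.add S_left S_right)
  \<comment> \<open>In the nine identities the left, right and total operations occur only under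
    \<open>R\<close> or \<open>S\<close>, so those rules remove them; up and down never do and are
    unfolded to match the dendriform axioms.\<close>
  show ?thesis
    by unfold_locales
      (simp_all only: bilinear_op_compose_left bilinear_op_compose_right
        bilinear_prec bilinear_succ linear_R linear_S
        R_left S_left R_right S_right R_total S_total
        Q.up_op_def Q.down_op_def prec_prec succ_prec succ_succ)
qed

end
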